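(* Let $G=(V,E)$ be a graph with $n=|V|$ vertices and $m=|E|$ edges, let $k\ge 2$ be an integer, and let $P=\{1,\dots,k\}$. Let $\mathcal{R}^{y}_{\mathrm{BQO}}$ and $\mathcal{R}_{\mathrm{V\text{-}MILO}}$ be the sets defined in the context. Then $\mathcal{R}^{y}_{\mathrm{BQO}}\subset\mathcal{R}_{\mathrm{V\text{-}MILO}}$, where $\subset$ denotes strict inclusion; that is, the continuous relaxation of the binary quadratic optimization formulation is stronger than that of the vertex-based mixed integer linear optimization formulation.
   Context: Coordinates: $x=(x_{vj})_{v\in V,\,j\in P}\in\mathbb{R}^{n\times k}$ and $y=(y_{uv})_{\{u,v\}\in E}\in\mathbb{R}^{m}$, where $y_{uv}$ is indexed by the unordered edge $\{u,v\}$. The max $k$-cut problem on $G$ with edge weights $w_{uv}\in\mathbb{R}$ seeks a partition of $V$ into at most $k$ parts maximizing the total weight of edges whose endpoints lie in different parts. Its binary quadratic optimization (BQO) formulation maximizes $\sum_{\{u,v\}\in E}w_{uv}\big(1-\sum_{j\in P}x_{uj}x_{vj}\big)$ subject to $\sum_{j\in P}x_{vj}=1$ for all $v\in V$ and $x\in\{0,1\}^{n\times k}$. The lifted continuous relaxation of the BQO formulation is $$\mathcal{R}^{y}_{\mathrm{BQO}}=\Big\{(x,y)\in[0,1]^{n\times k}\times\mathbb{R}^{m} : \sum_{j\in P}x_{vj}=1\ \ \forall v\in V,\quad y_{uv}=1-\sum_{j\in P}x_{uj}x_{vj}\ \ \forall\{u,v\}\in E\Big\}.$$ The vertex-based mixed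 integer linear optimization (V-MILO) formulation maximizes $\sum_{\{u,v\}\in E}w_{uv}y_{uv}$ over $x\in\{0,1\}^{n\times k}$, $y\in\{0,1\}^m$ satisfying (a)–(c) below. The polytope of its continuous relaxation, $\mathcal{R}_{\mathrm{V\text{-}MILO}}$, is the set of all $(x,y)\in[0,1]^{n\times k}\times[0,1]^{m}$ such that (a) $\sum_{j\in P}x_{vj}=1$ for all $v\in V$; (b) $x_{uj}-x_{vj}\le y_{uv}$ and $x_{vj}-x_{uj}\le y_{uv}$ for all $\{u,v\}\in E$, $j\in P$; (c) $x_{uj}+x_{vj}+y_{uv}\le 2$ for all $\{u,v\}\in E$, $j\in P$.
   Formalization: The graph is assumed to have at least one edge (m ≥ 1); for an edgeless graph the two relaxations coincide, so the strict inclusion as stated fails there. *)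

theory Defs
  imports Complex_Main "HOL-Library.FuncSet"
begin

text \<open>
  Edges are unordered pairs of distinct vertices, that is, two-element subsets of \<open>V\<close>.
\<close>

definition simple_graph :: "'a set \<Rightarrow> 'a set set \<Rightarrow> bool" where
  "simple_graph V E \<longleftrightarrow> finite V \<and> E \<subseteq> {e. e \<subseteq> V \<and> card e = 2}"

text \<open>
  Points of \<open>\<real>\<close>-spaces indexed by \<open>V \<times> P\<close> and by \<open>E\<close> are extensional functions, so that
  distinct functions represent distinct points and the sets below can be compared by
  inclusion. An edge coordinate is \<open>y {u, v}\<close>; the quantification over ordered pairs with
  \<open>{u, v} \<in> E\<close> visits every edge in both orientations.
\<close>

abbreviation parts :: "nat \<Rightarrow> nat set" where
  "parts k \<equiv> {1..k}"

definition R_BQO_y :: "'a set \<Rightarrow> 'a set set \<Rightarrow> nat \<Rightarrow> (('a \<times> nat \<Rightarrow> real) \<times> ('a set \<Rightarrow> real)) set" where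
  "R_BQO_y V E k =
    {(x, y). x \<in> (V \<times> parts k) \<rightarrow>\<^sub>E {0..1} \<and> y \<in> E \<rightarrow>\<^sub>E UNIV \<and>
       (\<forall>v\<in>V. (\<Sum>j\<in>parts k. x (v, j)) = 1) \<and>
       (\<forall>u v. {u, v} \<in> E \<longrightarrow> y {u, v} = 1 - (\<Sum>j\<in>parts k. x (u, j) * x (v, j)))}"

definition R_V_MILO :: "'a set \<Rightarrow> 'a set set \<Rightarrow> nat \<Rightarrow> (('a \<times> nat \<Rightarrow> real) \<times> ('a set \<Rightarrow> real)) set" where
  "R_V_MILO V E k =
    {(x, y). x \<in> (V \<times> parts k) \<rightarrow>\<^sub>E {0..1} \<and> y \<in> E \<rightarrow>\<^sub>E {0..1} \<and>
       (\<forall>v\<in>V. (\<Sum>j\<in>parts k. x (v, j)) = 1) \<and>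
       (\<forall>u v. {u, v} \<in> E \<longrightarrow> (\<forall>j\<in>parts k.
          x (u, j) - x (v, j) \<le> y {u, v} \<and> x (v, j) - x (u, j) \<le> y {u, v})) \<and>
       (\<forall>u v. {u, v} \<in> E \<longrightarrow> (\<forall>j\<in>parts k. x (u, j) + x (v, j) + y {u, v} \<le> 2))}"

end

theory Submission imports Defs begin

text \<open>
  Fix an edge \<open>{u, v}\<close> and write \<open>a\<close> and \<open>b\<close> for the rows of \<open>x\<close> at \<open>u\<close> and \<open>v\<close>. Both are
  probability vectors, and the bilinear relaxation forces \<open>y {u, v} = 1 - (\<Sum>j. a j * b j)\<close>.
  Inclusion therefore amounts to bounds on the inner product of two probability vectors:
  it lies in \<open>[0, 1]\<close>; it is at least \<open>a j * b j \<ge> a j + b j - 1\<close>; and it is at most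
  \<open>b j + (1 - a j)\<close>, since the \<open>j\<close>-th term is at most \<open>b j\<close> and the others are bounded by the
  remaining mass \<open>1 - a j\<close> of \<open>a\<close> (\<open>prob_vector_inner_le\<close>, \<open>prob_vectors_inner_bounds\<close>).

  Inclusion is strict because the point with every \<open>x\<close> coordinate equal to \<open>1 / k\<close> and every
  \<open>y\<close> coordinate equal to \<open>0\<close> satisfies all the linear constraints, whereas the bilinear
  equation would require \<open>y {u, v} = 1 - 1 / k > 0\<close> on any edge.
\<close>

lemma prob_vector_inner_le:
  fixes a b :: "'i \<Rightarrow> real"
  assumes fin: "finite I" and j: "j \<in> I"
    and a: "\<And>i. i \<in> I \<Longrightarrow> 0 \<le> a i" and a1: "(\<Sum>i\<in>I. a i) = 1"
    and b: "\<And>i. i \<in> I \<Longrightarrow> 0 \<le> b i \<and> b i \<le> 1"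
  shows "(\<Sum>i\<in>I. a i * b i) \<le> b j + (1 - a j)"
proof -
  have aj: "a j + (\<Sum>i\<in>I - {j}. a i) = 1"
    using a1 sum.remove[OF fin j, of a] by simp
  have "0 \<le> (\<Sum>i\<in>I - {j}. a i)"
    using a by (intro sum_nonneg) auto
  then have "a j \<le> 1" using aj by simp
  then have "a j * b j \<le> b j"
    using b[OF j] mult_right_mono[of "a j" 1 "b j"] by simp
  moreover have "(\<Sum>i\<in>I - {j}. a i * b i) \<le> (\<Sum>i\<in>I - {j}. a i)"
    using a b by (intro sum_mono) (auto intro: mult_left_le)
  ultimately show ?thesis
    using aj sum.remove[OF fin j, of "\<lambda>i. a i * b i"] by simp
qed

lemma prob_vectors_inner_bounds:
  fixes a b :: "'i \<Rightarrow> real"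
  assumes fin: "finite I"
    and a: "\<And>i. i \<in> I \<Longrightarrow> 0 \<le> a i \<and> a i \<le> 1" and a1: "(\<Sum>i\<in>I. a i) = 1"
    and b: "\<And>i. i \<in> I \<Longrightarrow> 0 \<le> b i \<and> b i \<le> 1" and b1: "(\<Sum>i\<in>I. b i) = 1"
  defines "s \<equiv> \<Sum>i\<in>I. a i * b i"
  shows "0 \<le> s" and "s \<le> 1"
    and "j \<in> I \<Longrightarrow> a j - b j \<le> 1 - s"
    and "j \<in> I \<Longrightarrow> b j - a j \<le> 1 - s"
    and "j \<in> I \<Longrightarrow> a j + b j + (1 - s) \<le> 2"
proof -
  show "0 \<le> s"
    unfolding s_def using a b by (intro sum_nonneg) auto
  have "s \<le> (\<Sum>i\<in>I. a i)"
    unfolding s_def using a b by (intro sum_mono) (auto intro: mult_left_le)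
  then show "s \<le> 1" using a1 by simp
  show "a j - b j \<le> 1 - s" if "j \<in> I"
    using prob_vector_inner_le[OF fin that, of a b] a a1 b by (simp add: s_def)
  show "b j - a j \<le> 1 - s" if "j \<in> I"
    using prob_vector_inner_le[OF fin that, of b a] a b b1
    by (simp add: s_def mult.commute)
  show "a j + b j + (1 - s) \<le> 2" if j: "j \<in> I"
  proof -
    have "a j * b j \<le> s"
      unfolding s_def using a b by (intro member_le_sum[OF j _ fin]) auto
    moreover have "0 \<le> (1 - a j) * (1 - b j)"
      using a[OF j] b[OF j] by simp
    ultimately show ?thesis by (simp add: algebra_simps)
  qed
qed

lemma simple_graph_edgeE:
  assumes "simple_graph V E" and "e \<in> E"
  obtains u v where "e = {u, v}" "u \<in> V" "v \<in> V"
proof -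
  have "e \<subseteq> V" and "card e = 2"
    using assms by (auto simp: simple_graph_def)
  then obtain u v where "e = {u, v}" by (auto simp: card_2_iff)
  with \<open>e \<subseteq> V\<close> show ?thesis by (auto intro: that)
qed

lemma R_BQO_y_subset_R_V_MILO:
  assumes G: "simple_graph V E"
  shows "R_BQO_y V E k \<subseteq> R_V_MILO V E k"
proof
  fix p assume "p \<in> R_BQO_y V E k"
  then obtain x y where p: "p = (x, y)"
    and x: "x \<in> (V \<times> parts k) \<rightarrow>\<^sub>E {0..1}" and y: "y \<in> E \<rightarrow>\<^sub>E UNIV"
    and x1: "\<And>v. v \<in> V \<Longrightarrow> (\<Sum>j\<in>parts k. x (v, j)) = 1"
    and yE: "\<And>u v. {u, v} \<in> E \<Longrightarrow> y {u, v} = 1 - (\<Sum>j\<in>parts k. x (u, j) * x (v, j))"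
    by (auto simp: R_BQO_y_def)
  have x01: "0 \<le> x (v, j) \<and> x (v, j) \<le> 1" if "v \<in> V" "j \<in> parts k" for v j
    using PiE_mem[OF x, of "(v, j)"] that by simp
  have inV: "u \<in> V" "v \<in> V" if "{u, v} \<in> E" for u v
    using G that by (auto simp: simple_graph_def)
  have bounds: "0 \<le> y {u, v} \<and> y {u, v} \<le> 1 \<and>
      (\<forall>j\<in>parts k. x (u, j) - x (v, j) \<le> y {u, v} \<and> x (v, j) - x (u, j) \<le> y {u, v} \<and>
        x (u, j) + x (v, j) + y {u, v} \<le> 2)" if e: "{u, v} \<in> E" for u v
    using prob_vectors_inner_bounds[where I = "parts k" and a = "\<lambda>j. x (u, j)"
        and b = "\<lambda>j. x (v, j)"] x01 inV[OF e] x1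
    unfolding yE[OF e] by auto
  have "y e \<in> {0..1}" if "e \<in> E" for e
    using simple_graph_edgeE[OF G that] bounds that by (metis atLeastAtMost_iff)
  then have "y \<in> E \<rightarrow>\<^sub>E {0..1}"
    using y by (auto simp: PiE_iff)
  then show "p \<in> R_V_MILO V E k"
    using x x1 bounds by (auto simp: p R_V_MILO_def)
qed

theorem theorem2:
  fixes V :: "'a set" and E :: "'a set set" and k :: nat
  assumes "simple_graph V E"
    and "E \<noteq> {}"
    and "k \<ge> 2"
  shows "R_BQO_y V E k \<subset> R_V_MILO V E k"
proof -
  define x where "x = restrict (\<lambda>_. 1 / real k) (V \<times> parts k)"
  define y where "y = restrict (\<lambda>_. 0 :: real) E"
  have xv: "x (v, j) = 1 / real k" if "v \<in> V" "j \<in> parts k" for v j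
    using that by (simp add: x_def)
  have inV: "u \<in> V" "v \<in> V" if "{u, v} \<in> E" for u v
    using assms(1) that by (auto simp: simple_graph_def)
  have "(x, y) \<in> R_V_MILO V E k"
  proof -
    have "x \<in> (V \<times> parts k) \<rightarrow>\<^sub>E {0..1}" and "y \<in> E \<rightarrow>\<^sub>E {0..1}"
      using assms(3) by (auto simp: x_def y_def)
    moreover have "(\<Sum>j\<in>parts k. x (v, j)) = 1" if "v \<in> V" for v
      using that assms(3) by (simp add: xv)
    moreover have "1 / real k + 1 / real k \<le> 2"
      using assms(3) by (simp add: field_simps)
    ultimately show ?thesis
      using inV by (auto simp: R_V_MILO_def xv y_def)
  qed
  moreover have "(x, y) \<notin> R_BQO_y V E k"
  proof
    assume mem: "(x, y) \<in> R_BQO_y V E k"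
    obtain e where "e \<in> E" using assms(2) by blast
    then obtain u v where e: "{u, v} \<in> E" and uv: "u \<in> V" "v \<in> V"
      using simple_graph_edgeE[OF assms(1)] by metis
    have "y {u, v} = 1 - (\<Sum>j\<in>parts k. x (u, j) * x (v, j))"
      using mem e by (auto simp: R_BQO_y_def)
    also have "\<dots> = 1 - 1 / real k"
      using uv assms(3) by (simp add: xv)
    finally have "1 / real k = 1"
      using e by (simp add: y_def)
    then show False using assms(3) by simp
  qed
  ultimately show ?thesis
    using R_BQO_y_subset_R_V_MILO[OF assms(1), of k] by blast
qed

end
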